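(* Let $Y=\mathbb{P}^{n_1}\times\dots\times\mathbb{P}^{n_k}$, let $M=-1+\prod_{i=1}^k(n_i+1)$, let $\nu:Y\to\mathbb{P}^M$ be the Segre embedding, and assume $n_i>0$ for at least one $i$. Take a finite set $A\subset Y$ of cardinality $r\le M$ such that $\nu(A)$ is linearly independent. Take a general $T\in\langle\nu(A)\rangle$. Then there exists a non-redundant decomposition $S\subset Y$ of $T$ of cardinality $r+1$.
   Context: The base field is $\mathbb{C}$. $\langle Z\rangle$ denotes the linear span of a subset $Z$ of a projective space. A finite reduced set $S\subset Y$ is a decomposition of $T\in\mathbb{P}^M$ if $T\in\langle\nu(S)\rangle$; it is non-redundant if moreover $T\notin\langle\nu(S')\rangle$ for every $S'\subsetneq S$. "General $T\in\langle\nu(A)\rangle$" means every $T$ in some dense Zariski-open subset of $\langle\nu(A)\rangle$. *)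

theory Defs
  imports "HOL-Analysis.Analysis" "HOL-Library.Function_Algebras"
begin

definition cscale :: "complex \<Rightarrow> ('i \<Rightarrow> complex) \<Rightarrow> 'i \<Rightarrow> complex" where
  "cscale c v = (\<lambda>j. c * v j)"

interpretation cvec: vector_space "cscale :: complex \<Rightarrow> ('i \<Rightarrow> complex) \<Rightarrow> 'i \<Rightarrow> complex"
  by unfold_locales (auto simp: cscale_def fun_eq_iff algebra_simps)

(* The vector space C^J for a finite index set J is realised inside the full function space
   'i => complex as the functions vanishing off J. *)
definition coord_space :: "'i set \<Rightarrow> ('i \<Rightarrow> complex) set" where
  "coord_space J = {v. \<forall>j. j \<notin> J \<longrightarrow> v j = 0}"

(* A point of a projective space is a line through the origin, that is, a one-dimensional
   linear subspace (a set of vectors containing 0). *)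
definition proj_space :: "'i set \<Rightarrow> ('i \<Rightarrow> complex) set set" where
  "proj_space J = {cvec.span {v} |v. v \<in> coord_space J \<and> v \<noteq> 0}"

definition proj_span :: "('i \<Rightarrow> complex) set set \<Rightarrow> ('i \<Rightarrow> complex) set set" where
  "proj_span Z = {cvec.span {v} |v. v \<in> cvec.span (\<Union>Z) \<and> v \<noteq> 0}"

definition proj_independent :: "('i \<Rightarrow> complex) set set \<Rightarrow> bool" where
  "proj_independent Z \<longleftrightarrow> (\<forall>p\<in>Z. p \<notin> proj_span (Z - {p}))"

(* F is (the function given by) a homogeneous polynomial of degree d in the coordinates
   indexed by J; m runs over the exponent vectors of total degree d and a lists the
   coefficients. *)
definition homogeneous_form :: "'i set \<Rightarrow> nat \<Rightarrow> (('i \<Rightarrow> complex) \<Rightarrow> complex) \<Rightarrow> bool" where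
  "homogeneous_form J d F \<longleftrightarrow>
     (\<exists>a :: ('i \<Rightarrow> nat) \<Rightarrow> complex.
        F = (\<lambda>v. \<Sum>m\<in>{m \<in> J \<rightarrow>\<^sub>E {..d}. sum m J = d}. a m * (\<Prod>j\<in>J. v j ^ m j)))"

(* The sets F \<noteq> 0 form a base of the Zariski topology: they are closed under finite
   intersection, and the complement of the common zero locus of a family of forms is the
   union of the sets attached to its members. *)
definition principal_open :: "'i set \<Rightarrow> (('i \<Rightarrow> complex) \<Rightarrow> complex) \<Rightarrow> ('i \<Rightarrow> complex) set set" where
  "principal_open J F = {p \<in> proj_space J. \<exists>v\<in>p. F v \<noteq> 0}"

definition zariski :: "'i set \<Rightarrow> ('i \<Rightarrow> complex) set topology" where
  "zariski J = topology_generated_by {principal_open J F |F. \<exists>d. homogeneous_form J d F}"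

definition holds_for_general ::
    "'i set \<Rightarrow> ('i \<Rightarrow> complex) set set \<Rightarrow> (('i \<Rightarrow> complex) set \<Rightarrow> bool) \<Rightarrow> bool" where
  "holds_for_general J X P \<longleftrightarrow>
     (\<exists>U. openin (subtopology (zariski J) X) U \<and>
          subtopology (zariski J) X closure_of U = X \<and>
          (\<forall>T\<in>U. P T))"

definition multi_index :: "nat \<Rightarrow> (nat \<Rightarrow> nat) \<Rightarrow> (nat \<Rightarrow> nat) set" where
  "multi_index k n = (\<Pi>\<^sub>E i\<in>{1..k}. {..n i})"

definition multiproj :: "nat \<Rightarrow> (nat \<Rightarrow> nat) \<Rightarrow> (nat \<Rightarrow> (nat \<Rightarrow> complex) set) set" where
  "multiproj k n = (\<Pi>\<^sub>E i\<in>{1..k}. proj_space {..n i})"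

definition tensor :: "nat \<Rightarrow> (nat \<Rightarrow> nat) \<Rightarrow> (nat \<Rightarrow> nat \<Rightarrow> complex) \<Rightarrow> (nat \<Rightarrow> nat) \<Rightarrow> complex" where
  "tensor k n v = (\<lambda>m. if m \<in> multi_index k n then \<Prod>i=1..k. v i (m i) else 0)"

(* The homogeneous coordinates of the target of the Segre embedding are indexed by
   multi_index k n, which has prod (n i + 1) = M + 1 elements. All choices of representatives
   v i of y i give proportional tensors, so the span below is the line of any nonzero one. *)
definition segre :: "nat \<Rightarrow> (nat \<Rightarrow> nat) \<Rightarrow> (nat \<Rightarrow> (nat \<Rightarrow> complex) set) \<Rightarrow> ((nat \<Rightarrow> nat) \<Rightarrow> complex) set" where
  "segre k n y = cvec.span {tensor k n v |v. \<forall>i\<in>{1..k}. v i \<in> y i}"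

definition is_decomposition ::
    "nat \<Rightarrow> (nat \<Rightarrow> nat) \<Rightarrow> (nat \<Rightarrow> (nat \<Rightarrow> complex) set) set \<Rightarrow> ((nat \<Rightarrow> nat) \<Rightarrow> complex) set \<Rightarrow> bool" where
  "is_decomposition k n S T \<longleftrightarrow>
     finite S \<and> S \<subseteq> multiproj k n \<and> T \<in> proj_span (segre k n ` S)"

definition nonredundant_decomposition ::
    "nat \<Rightarrow> (nat \<Rightarrow> nat) \<Rightarrow> (nat \<Rightarrow> (nat \<Rightarrow> complex) set) set \<Rightarrow> ((nat \<Rightarrow> nat) \<Rightarrow> complex) set \<Rightarrow> bool" where
  "nonredundant_decomposition k n S T \<longleftrightarrow>
     is_decomposition k n S T \<and> (\<forall>S'. S' \<subset> S \<longrightarrow> T \<notin> proj_span (segre k n ` S'))"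

end

theory Submission
  imports Defs
begin

text \<open>Let \<open>L\<close> be the linear span of the tensors of the points of \<open>A\<close>; it is a proper subspace because
  \<open>r \<le> M\<close>. Some line in the Segre variety through a point \<open>a\<close> of \<open>A\<close> leaves \<open>L\<close>: otherwise \<open>L\<close> would be
  stable under the elementary matrices acting on the individual tensor factors, hence everything.
  On such a line write the tensor of \<open>a\<close> as the sum of the tensors of two further points \<open>b\<close> and \<open>c\<close>.
  Then \<open>S = (A - {a}) \<union> {b, c}\<close> maps to \<open>r + 1\<close> linearly independent vectors, and a combination of \<open>A\<close> with
  nonzero coefficients is a combination of \<open>S\<close> with nonzero coefficients, so \<open>S\<close> is non-redundant. The
  nonvanishing of all coefficients is a dense Zariski-open condition.\<close>

section \<open>Zariski-general points of a linear span\<close>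

definition unit_vec :: "'i \<Rightarrow> 'i \<Rightarrow> complex" where
  "unit_vec j = (\<lambda>i. if i = j then 1 else 0)"

lemma sum_vec_apply: "sum f A j = (\<Sum>x\<in>A. f x j)" for f :: "'a \<Rightarrow> 'i \<Rightarrow> complex"
  by (induction A rule: infinite_finite_induct) auto

lemma subspace_coord_space: "cvec.subspace (coord_space J)"
  by (auto simp: cvec.subspace_def coord_space_def cscale_def)

lemma coord_space_expansion:
  assumes "finite J" "v \<in> coord_space J"
  shows "v = (\<Sum>j\<in>J. cscale (v j) (unit_vec j))"
  using assms by (auto simp: fun_eq_iff sum_vec_apply cscale_def unit_vec_def coord_space_def if_distrib cong: if_cong)

lemma span_singleton_scale:
  assumes "c \<noteq> 0"
  shows "cvec.span {cscale c v} = cvec.span {v}"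
proof -
  have "v = cscale (1 / c) (cscale c v)"
    using assms by (simp add: fun_eq_iff cscale_def)
  then have "v \<in> cvec.span {cscale c v}"
    by (metis cvec.span_base cvec.span_scale singletonI)
  moreover have "cscale c v \<in> cvec.span {v}"
    by (simp add: cvec.span_base cvec.span_scale)
  ultimately show ?thesis
    by (simp add: cvec.span_eq)
qed

lemma span_singleton_eqD:
  assumes "cvec.span {v} = cvec.span {w}" "v \<noteq> 0"
  obtains c where "c \<noteq> 0" "v = cscale c w"
proof -
  have "v \<in> cvec.span {w}"
    using assms(1) cvec.span_base by blast
  then obtain c where "v = cscale c w"
    by (auto simp: cvec.span_singleton)
  moreover from this have "c \<noteq> 0"
    using assms(2) by auto
  ultimately show ?thesis
    using that by blast
qed

text \<open>Spans of projective points are unions of lines in the definitions. This passage to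
  representative vectors is what reduces every later claim to linear algebra.\<close>

lemma span_Union_lines:
  assumes "\<And>s. s \<in> S \<Longrightarrow> g s = cvec.span {t s}"
  shows "cvec.span (\<Union>(g ` S)) = cvec.span (t ` S)"
proof (subst cvec.span_eq, intro conjI subsetI)
  fix v assume "v \<in> \<Union>(g ` S)"
  then obtain s where "s \<in> S" "v \<in> cvec.span {t s}"
    using assms by auto
  then show "v \<in> cvec.span (t ` S)"
    using cvec.span_mono[of "{t s}" "t ` S"] by auto
next
  fix v assume "v \<in> t ` S"
  then obtain s where "s \<in> S" "v \<in> g s"
    using assms cvec.span_base by fastforce
  then show "v \<in> cvec.span (\<Union>(g ` S))"
    by (intro cvec.span_base) auto
qed

section \<open>Homogeneous forms and principal open sets\<close>

lemma homogeneous_form_scale: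
  assumes "homogeneous_form J d F" "finite J"
  shows "F (cscale c v) = c ^ d * F v"
proof -
  obtain a where a: "F = (\<lambda>v. \<Sum>m\<in>{m \<in> J \<rightarrow>\<^sub>E {..d}. sum m J = d}. a m * (\<Prod>j\<in>J. v j ^ m j))"
    using assms(1) by (auto simp: homogeneous_form_def)
  show ?thesis
    unfolding a sum_distrib_left
    by (intro sum.cong) (auto simp: cscale_def power_mult_distrib prod.distrib power_sum)
qed

lemma continuous_on_homogeneous_form:
  fixes v :: "complex \<Rightarrow> 'i \<Rightarrow> complex"
  assumes "homogeneous_form J d F" and "\<And>j. continuous_on UNIV (\<lambda>z. v z j)"
  shows "continuous_on UNIV (\<lambda>z. F (v z))"
proof -
  obtain a where a: "F = (\<lambda>v. \<Sum>m\<in>{m \<in> J \<rightarrow>\<^sub>E {..d}. sum m J = d}. a m * (\<Prod>j\<in>J. v j ^ m j))"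
    using assms(1) by (auto simp: homogeneous_form_def)
  show ?thesis
    unfolding a by (intro continuous_intros assms(2))
qed

lemma exponents_of_degree_one:
  assumes "finite J"
  shows "{m \<in> J \<rightarrow>\<^sub>E {..1::nat}. sum m J = 1} = (\<lambda>j. \<lambda>i\<in>J. if i = j then 1 else 0) ` J"
proof (intro equalityI subsetI)
  fix m assume m: "m \<in> {m \<in> J \<rightarrow>\<^sub>E {..1::nat}. sum m J = 1}"
  then obtain j where j: "j \<in> J" "m j = 1" "\<And>i. i \<in> J \<Longrightarrow> i \<noteq> j \<Longrightarrow> m i = 0"
    using sum_eq_1_iff[OF assms, of m] by auto
  have "m = (\<lambda>i\<in>J. if i = j then 1 else 0)"
  proof
    fix i
    show "m i = (\<lambda>i\<in>J. if i = j then 1 else 0) i"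
      using m j PiE_arb[of m J _ i] by (cases "i \<in> J"; cases "i = j") auto
  qed
  then show "m \<in> (\<lambda>j. \<lambda>i\<in>J. if i = j then 1 else 0) ` J"
    using j(1) by blast
qed (use assms in auto)

lemma homogeneous_form_linear:
  assumes "finite J"
  shows "homogeneous_form J 1 (\<lambda>v. \<Sum>j\<in>J. v j * b j)"
proof -
  define e where "e j = (\<lambda>i\<in>J. if i = j then 1 else (0::nat))" for j
  have inj: "inj_on e J"
    by (rule inj_onI) (auto simp: e_def fun_eq_iff split: if_splits)
  \<comment> \<open>The degree-one exponent vectors are exactly the \<open>e j\<close>. As
    \<open>e\<close> is injective on \<open>J\<close>, its inverse tells which coefficient
    \<open>b j\<close> an exponent vector carries.\<close>
  have "(\<Sum>m\<in>{m \<in> J \<rightarrow>\<^sub>E {..1}. sum m J = 1}. b (the_inv_into J e m) * (\<Prod>j\<in>J. v j ^ m j)) =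
        (\<Sum>j\<in>J. v j * b j)" for v
  proof -
    have "(\<Sum>m\<in>{m \<in> J \<rightarrow>\<^sub>E {..1}. sum m J = 1}. b (the_inv_into J e m) * (\<Prod>j\<in>J. v j ^ m j)) =
          (\<Sum>j\<in>J. b (the_inv_into J e (e j)) * (\<Prod>i\<in>J. v i ^ e j i))"
      using exponents_of_degree_one[OF assms] by (simp add: e_def[symmetric] sum.reindex[OF inj])
    also have "\<dots> = (\<Sum>j\<in>J. v j * b j)"
    proof (rule sum.cong)
      fix j assume "j \<in> J"
      then have "(\<Prod>i\<in>J. v i ^ e j i) = (\<Prod>i\<in>J. if i = j then v i else 1)"
        by (intro prod.cong) (auto simp: e_def)
      then show "b (the_inv_into J e (e j)) * (\<Prod>i\<in>J. v i ^ e j i) = v j * b j"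
        using \<open>j \<in> J\<close> assms by (simp add: the_inv_into_f_f[OF inj])
    qed simp
    finally show ?thesis .
  qed
  then show ?thesis
    unfolding homogeneous_form_def by (intro exI[of _ "\<lambda>m. b (the_inv_into J e m)"]) (simp add: fun_eq_iff)
qed

text \<open>By homogeneity, \<open>F\<close> takes at any multiple of \<open>v\<close> a power of
  the scalar times \<open>F v\<close>, so one representative decides membership.\<close>

lemma line_mem_principal_open:
  assumes "homogeneous_form J d F" "finite J" "v \<in> coord_space J" "v \<noteq> 0"
  shows "cvec.span {v} \<in> principal_open J F \<longleftrightarrow> F v \<noteq> 0"
proof
  assume "cvec.span {v} \<in> principal_open J F"
  then obtain c where "F (cscale c v) \<noteq> 0"
    by (auto simp: principal_open_def cvec.span_singleton)
  then show "F v \<noteq> 0"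
    by (simp add: homogeneous_form_scale[OF assms(1,2)])
next
  assume "F v \<noteq> 0"
  then show "cvec.span {v} \<in> principal_open J F"
    using assms(3,4) cvec.span_base by (auto simp: principal_open_def proj_space_def)
qed

text \<open>The carrier of a generated topology is the union of its generators, so the principal
  open sets have to cover. A coordinate form that does not vanish at a given vector does
  this.\<close>

lemma topspace_zariski:
  assumes "finite J"
  shows "topspace (zariski J) = proj_space J"
proof (intro equalityI subsetI)
  fix p assume "p \<in> proj_space J"
  then obtain v where v: "v \<in> coord_space J" "v \<noteq> 0" "p = cvec.span {v}"
    by (auto simp: proj_space_def)
  then obtain j where j: "v j \<noteq> 0" "j \<in> J"
    by (auto simp: fun_eq_iff coord_space_def)
  define F where "F = (\<lambda>w :: 'a \<Rightarrow> complex. \<Sum>i\<in>J. w i * unit_vec j i)"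
  have F: "homogeneous_form J 1 F"
    unfolding F_def by (rule homogeneous_form_linear[OF assms])
  have "F v = v j"
    using assms j by (simp add: F_def unit_vec_def if_distrib cong: if_cong)
  then have "p \<in> principal_open J F"
    using line_mem_principal_open[OF F assms] v j by simp
  then show "p \<in> topspace (zariski J)"
    using F by (auto simp: zariski_def)
qed (auto simp: zariski_def principal_open_def)

text \<open>The Zariski topology is coarser than the classical one; this yields irreducibility of linear
  subspaces by moving a little along a line.\<close>

lemma eventually_zariski_open:
  assumes "openin (zariski J) W" "finite J"
    and "w \<in> coord_space J" "u \<in> coord_space J" "w \<noteq> 0" "cvec.span {w} \<in> W"
    and nz: "eventually (\<lambda>z. w + cscale z u \<noteq> 0) (at 0)"
  shows "eventually (\<lambda>z. cvec.span {w + cscale z u} \<in> W) (at 0)"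
proof -
  have "generate_topology_on {principal_open J F |F. \<exists>d. homogeneous_form J d F} W"
    using assms(1) by (simp add: zariski_def openin_topology_generated_by_iff)
  then show ?thesis
    using \<open>cvec.span {w} \<in> W\<close>
  proof (induction rule: generate_topology_on.induct)
    case (Int a b)
    then show ?case by (auto intro: eventually_conj)
  next
    case (UN K)
    then obtain V where V: "V \<in> K" "cvec.span {w} \<in> V"
      by blast
    show ?case
      by (rule eventually_mono[OF UN.IH[OF V]]) (use V in blast)
  next
    case (Basis V)
    then obtain d F where F: "homogeneous_form J d F" "V = principal_open J F"
      by blast
    \<comment> \<open>Only generators need analysis: along the line the form is a continuous
      function of \<open>z\<close>, nonzero at \<open>z = 0\<close>. The assumption
      \<open>nz\<close> then keeps the moved vector a representative of a projective point.\<close>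
    have "continuous_on UNIV (\<lambda>z. F (w + cscale z u))"
      by (rule continuous_on_homogeneous_form[OF F(1)]) (auto simp: cscale_def intro!: continuous_intros)
    then have "((\<lambda>z. F (w + cscale z u)) \<longlongrightarrow> F (w + cscale 0 u)) (at 0)"
      unfolding continuous_on_def by blast
    moreover have "cvec.span {w} \<in> principal_open J F"
      using Basis.prems F(2) by blast
    then have "F (w + cscale 0 u) \<noteq> 0"
      using line_mem_principal_open[OF F(1) assms(2,3,5)] by simp
    ultimately have "eventually (\<lambda>z. F (w + cscale z u) \<noteq> 0) (at 0)"
      by (rule tendsto_imp_eventually_ne)
    then show ?case
      using nz
    proof eventually_elim
      case (elim z)
      have "w + cscale z u \<in> coord_space J"
        by (intro cvec.subspace_add cvec.subspace_scale subspace_coord_space assms(3,4))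
      then have "cvec.span {w + cscale z u} \<in> principal_open J F \<longleftrightarrow> F (w + cscale z u) \<noteq> 0"
        using elim(2) by (rule line_mem_principal_open[OF F(1) assms(2)])
      then show ?case
        unfolding F(2) using elim(1) by (rule iffD2)
    qed
  qed simp
qed

section \<open>Density of the points with all coefficients nonzero\<close>

lemma sum_scaled_basis_neq_0:
  assumes "finite B" "cvec.independent B" "b \<in> B" "c b \<noteq> 0"
  shows "(\<Sum>b\<in>B. cscale (c b) b) \<noteq> 0"
  using assms cvec.dependent_finite[OF assms(1)] by blast

text \<open>The points with all coordinates nonzero relative to \<open>B\<close> form the required
  set: it is the complement of finitely many hyperplanes in the span, hence open, and a small shift
  of all coefficients moves any point into it, hence dense.\<close>

lemma holds_for_general_span:
  assumes "finite J" "finite B" "B \<noteq> {}" "cvec.independent B" "B \<subseteq> coord_space J"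
    and span: "cvec.span (\<Union>Z) = cvec.span B"
    and P: "\<And>c. (\<And>b. b \<in> B \<Longrightarrow> c b \<noteq> 0) \<Longrightarrow> P (cvec.span {\<Sum>b\<in>B. cscale (c b) b})"
  shows "holds_for_general J (proj_span Z) P"
proof -
  define comb where "comb c = (\<Sum>b\<in>B. cscale (c b) b)" for c :: "('a \<Rightarrow> complex) \<Rightarrow> complex"
  define U where "U = {cvec.span {comb c} |c. \<forall>b\<in>B. c b \<noteq> 0}"
  \<comment> \<open>Extending \<open>B\<close> to a basis of the whole space makes the coordinate
    functionals linear everywhere, in particular at unit vectors outside the span of
    \<open>B\<close>.\<close>
  define rep where "rep = cvec.representation (cvec.extend_basis B)"
  have X: "proj_span Z = {cvec.span {comb c} |c. comb c \<noteq> 0}"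
    unfolding proj_span_def span cvec.span_finite[OF \<open>finite B\<close>] comb_def by blast
  have comb_coord: "comb c \<in> coord_space J" for c
    unfolding comb_def
    using assms(5) by (intro cvec.subspace_sum subspace_coord_space cvec.subspace_scale) auto
  have comb_nz: "comb c \<noteq> 0" if "\<forall>b\<in>B. c b \<noteq> 0" for c
    using sum_scaled_basis_neq_0[OF assms(2,4)] assms(3) that unfolding comb_def by blast
  have U_sub: "U \<subseteq> proj_span Z"
    using comb_nz by (auto simp: U_def X)
  have X_sub: "proj_span Z \<subseteq> proj_space J"
    using comb_coord by (auto simp: X proj_space_def)
  have ind: "cvec.independent (cvec.extend_basis B)"
    by (rule cvec.independent_extend_basis[OF assms(4)])
  have rep_comb: "rep (comb c) b = c b" if "b \<in> B" for b c
  proof -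
    have "rep (comb c) b = (\<Sum>b'\<in>B. rep (cscale (c b') b') b)"
      unfolding rep_def comb_def
      by (subst cvec.representation_sum[OF ind]) (simp_all add: assms(4))
    also have "\<dots> = (\<Sum>b'\<in>B. c b' * (if b = b' then 1 else 0))"
    proof (rule sum.cong)
      fix b' assume "b' \<in> B"
      then have "b' \<in> cvec.extend_basis B"
        using cvec.extend_basis_superset[OF assms(4)] by blast
      then show "rep (cscale (c b') b') b = c b' * (if b = b' then 1 else 0)"
        unfolding rep_def using ind
        by (simp add: cvec.representation_scale cvec.representation_basis assms(4))
    qed simp
    finally show ?thesis
      using that assms(2) by (simp add: if_distrib cong: if_cong)
  qed
  \<comment> \<open>The \<open>b\<close>-th coordinate functional, written through its values on
    unit vectors, becomes an honest linear form on the ambient space.\<close>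
  define F where "F b v = (\<Sum>j\<in>J. v j * rep (unit_vec j) b)" for b v
  have F: "homogeneous_form J 1 (F b)" for b
    unfolding F_def by (rule homogeneous_form_linear[OF assms(1)])
  have F_comb: "F b (comb c) = c b" if "b \<in> B" for b c
  proof -
    have "rep (comb c) b = rep (\<Sum>j\<in>J. cscale (comb c j) (unit_vec j)) b"
      using coord_space_expansion[OF assms(1) comb_coord] by simp
    also have "\<dots> = F b (comb c)"
      unfolding rep_def F_def
      by (subst cvec.representation_sum[OF ind])
        (simp_all add: assms(4) cvec.representation_scale[OF ind])
    finally show ?thesis
      using rep_comb[OF that] by simp
  qed
  have U_eq: "U = proj_span Z \<inter> (\<Inter>b\<in>B. principal_open J (F b))"
  proof (intro equalityI subsetI)
    fix p assume "p \<in> U"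
    then obtain c where c: "p = cvec.span {comb c}" "\<forall>b\<in>B. c b \<noteq> 0"
      by (auto simp: U_def)
    then show "p \<in> proj_span Z \<inter> (\<Inter>b\<in>B. principal_open J (F b))"
      using \<open>p \<in> U\<close> U_sub line_mem_principal_open[OF F assms(1) comb_coord comb_nz] F_comb by auto
  next
    fix p assume p: "p \<in> proj_span Z \<inter> (\<Inter>b\<in>B. principal_open J (F b))"
    then obtain c where c: "p = cvec.span {comb c}" "comb c \<noteq> 0"
      by (auto simp: X)
    then have "c b \<noteq> 0" if "b \<in> B" for b
      using p that line_mem_principal_open[OF F assms(1) comb_coord c(2)] F_comb[OF that] by auto
    then show "p \<in> U"
      using c by (auto simp: U_def)
  qed
  have "openin (zariski J) (\<Inter>b\<in>B. principal_open J (F b))"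
    using assms(2,3) F
    by (intro openin_INT2) (auto simp: zariski_def intro!: topology_generated_by_Basis)
  then have op: "openin (subtopology (zariski J) (proj_span Z)) U"
    unfolding U_eq by (rule openin_subtopology_Int2)
  have "p \<in> zariski J closure_of U" if p: "p \<in> proj_span Z" for p
    unfolding in_closure_of
  proof (intro conjI allI impI)
    show "p \<in> topspace (zariski J)"
      using p X_sub topspace_zariski[OF assms(1)] by blast
    fix W assume W: "p \<in> W \<and> openin (zariski J) W"
    obtain c where c: "p = cvec.span {comb c}" "comb c \<noteq> 0"
      using p by (auto simp: X)
    \<comment> \<open>Moving towards the sum of all basis vectors shifts every coefficient by the
      same \<open>z\<close>, so only finitely many \<open>z\<close> leave a zero
      coefficient.\<close>
    have line: "comb c + cscale z (comb (\<lambda>_. 1)) = comb (\<lambda>b. c b + z)" for z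
      by (simp add: comb_def cvec.scale_sum_right cvec.scale_left_distrib sum.distrib)
    have ev: "eventually (\<lambda>z. \<forall>b\<in>B. c b + z \<noteq> 0) (at 0)"
    proof (rule eventually_ball_finite[OF assms(2)], rule ballI)
      fix b
      have "eventually (\<lambda>z. z \<noteq> - c b) (at 0)"
        by (rule eventually_neq_at_within)
      then show "eventually (\<lambda>z. c b + z \<noteq> 0) (at 0)"
        by eventually_elim (auto simp: add_eq_0_iff)
    qed
    have "eventually (\<lambda>z. comb c + cscale z (comb (\<lambda>_. 1)) \<noteq> 0) (at 0)"
      using ev by eventually_elim (auto simp: line comb_nz)
    with W c have "eventually (\<lambda>z. cvec.span {comb c + cscale z (comb (\<lambda>_. 1))} \<in> W) (at 0)"
      by (intro eventually_zariski_open[OF _ assms(1) comb_coord comb_coord]) auto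
    with ev have "eventually (\<lambda>z. cvec.span {comb (\<lambda>b. c b + z)} \<in> U \<inter> W) (at 0)"
      by eventually_elim (auto simp: line U_def)
    then have "\<exists>z. cvec.span {comb (\<lambda>b. c b + z)} \<in> U \<inter> W"
      using eventually_happens'[of "at (0::complex)"] by simp
    then show "\<exists>y. y \<in> U \<and> y \<in> W"
      by blast
  qed
  then have cl: "subtopology (zariski J) (proj_span Z) closure_of U = proj_span Z"
    using U_sub by (auto simp: closure_of_subtopology Int_absorb1)
  have "\<forall>T\<in>U. P T"
    using P by (auto simp: U_def comb_def)
  with op cl show ?thesis
    unfolding holds_for_general_def by blast
qed

section \<open>Tensors and the Segre embedding\<close>

definition homog_coords :: "nat \<Rightarrow> (nat \<Rightarrow> nat) \<Rightarrow> (nat \<Rightarrow> nat \<Rightarrow> complex) \<Rightarrow> bool" where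
  "homog_coords k n x \<longleftrightarrow> (\<forall>i\<in>{1..k}. x i \<in> coord_space {..n i} \<and> x i \<noteq> 0)"

text \<open>The restriction to \<open>{1..k}\<close> places the result in the extensional product
  used by \<open>multiproj\<close>.\<close>

definition point :: "nat \<Rightarrow> (nat \<Rightarrow> nat \<Rightarrow> complex) \<Rightarrow> nat \<Rightarrow> (nat \<Rightarrow> complex) set" where
  "point k x = (\<lambda>i\<in>{1..k}. cvec.span {x i})"

lemma multiproj_eq_image_point: "multiproj k n = point k ` {x. homog_coords k n x}"
proof (intro equalityI subsetI)
  fix y assume y: "y \<in> multiproj k n"
  then have "\<forall>i\<in>{1..k}. \<exists>v. v \<in> coord_space {..n i} \<and> v \<noteq> 0 \<and> y i = cvec.span {v}"
    by (auto simp: multiproj_def proj_space_def dest!: PiE_mem)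
  then obtain x where x: "\<forall>i\<in>{1..k}. x i \<in> coord_space {..n i} \<and> x i \<noteq> 0 \<and> y i = cvec.span {x i}"
    by metis
  have "y = point k x"
  proof
    fix i
    show "y i = point k x i"
      using x y PiE_arb[of y "{1..k}" _ i] by (cases "i \<in> {1..k}") (auto simp: point_def multiproj_def)
  qed
  then show "y \<in> point k ` {x. homog_coords k n x}"
    using x by (auto simp: homog_coords_def)
next
  fix y assume "y \<in> point k ` {x. homog_coords k n x}"
  then show "y \<in> multiproj k n"
    unfolding multiproj_def point_def homog_coords_def proj_space_def by (auto intro!: PiE_I)
qed

lemma finite_multi_index: "finite (multi_index k n)"
  by (simp add: multi_index_def finite_PiE)

lemma card_multi_index: "card (multi_index k n) = (\<Prod>i=1..k. n i + 1)"
  by (simp add: multi_index_def card_PiE)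

lemma multi_index_fun_upd_iff:
  assumes "i \<in> {1..k}" "p \<le> n i" "m i \<le> n i"
  shows "m(i := p) \<in> multi_index k n \<longleftrightarrow> m \<in> multi_index k n"
proof -
  have "(m(i := p)) j \<in> {..n j} \<longleftrightarrow> m j \<in> {..n j}" for j
    using assms by simp
  moreover have "m(i := p) \<in> extensional {1..k} \<longleftrightarrow> m \<in> extensional {1..k}"
    using assms(1) by (auto simp: extensional_def)
  ultimately show ?thesis
    unfolding multi_index_def PiE_iff by blast
qed

section \<open>Multilinearity of decomposable tensors\<close>

lemma tensor_in_coord_space: "tensor k n x \<in> coord_space (multi_index k n)"
  by (simp add: tensor_def coord_space_def)

lemma tensor_cong:
  assumes "\<And>i. i \<in> {1..k} \<Longrightarrow> x i = y i"
  shows "tensor k n x = tensor k n y"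
proof -
  have "(\<Prod>i=1..k. x i (m i)) = (\<Prod>i=1..k. y i (m i))" for m
    using assms by (intro prod.cong) auto
  then show ?thesis
    by (simp only: tensor_def)
qed

lemma tensor_scale:
  "tensor k n (\<lambda>i. cscale (c i) (x i)) = cscale (\<Prod>i=1..k. c i) (tensor k n x)"
  by (auto simp: tensor_def fun_eq_iff cscale_def prod.distrib)

lemma tensor_fun_upd_apply:
  assumes "i \<in> {1..k}"
  shows "tensor k n (x(i := u)) m =
    (if m \<in> multi_index k n then u (m i) * (\<Prod>j\<in>{1..k} - {i}. x j (m j)) else 0)"
proof -
  have "(\<Prod>j=1..k. (x(i := u)) j (m j)) = u (m i) * (\<Prod>j\<in>{1..k} - {i}. (x(i := u)) j (m j))"
    using assms by (subst prod.remove[of _ i]) auto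
  also have "(\<Prod>j\<in>{1..k} - {i}. (x(i := u)) j (m j)) = (\<Prod>j\<in>{1..k} - {i}. x j (m j))"
    by (intro prod.cong) auto
  finally show ?thesis
    by (simp add: tensor_def)
qed

lemma tensor_fun_upd_diff:
  assumes "i \<in> {1..k}"
  shows "tensor k n (x(i := u - w)) = tensor k n (x(i := u)) - tensor k n (x(i := w))"
  by (simp add: fun_eq_iff tensor_fun_upd_apply[OF assms] left_diff_distrib)

text \<open>A nonvanishing coordinate is chosen in each factor separately. The factorwise conclusion
  is kept because later arguments vary one index at a time.\<close>

lemma tensor_nonzero_entry:
  assumes "homog_coords k n x"
  obtains m where "m \<in> multi_index k n" "\<And>i. i \<in> {1..k} \<Longrightarrow> x i (m i) \<noteq> 0" "tensor k n x m \<noteq> 0"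
proof -
  have "\<forall>i\<in>{1..k}. \<exists>p. p \<le> n i \<and> x i p \<noteq> 0"
    using assms by (fastforce simp: homog_coords_def coord_space_def fun_eq_iff)
  then obtain m where m: "\<forall>i\<in>{1..k}. m i \<le> n i \<and> x i (m i) \<noteq> 0"
    by metis
  show ?thesis
    by (rule that[of "restrict m {1..k}"]) (use m in \<open>auto simp: multi_index_def tensor_def\<close>)
qed

lemma tensor_neq_0:
  assumes "homog_coords k n x"
  shows "tensor k n x \<noteq> 0"
proof -
  obtain m where "tensor k n x m \<noteq> 0"
    using tensor_nonzero_entry[OF assms] .
  then show ?thesis
    by auto
qed

text \<open>Rescaling the representatives multiplies the tensor by the product of the scalars, so
  all generators of the span in \<open>segre\<close> lie on one line.\<close>

lemma segre_point: "segre k n (point k x) = cvec.span {tensor k n x}"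
proof -
  have "cvec.span {tensor k n v |v. \<forall>i\<in>{1..k}. v i \<in> point k x i} = cvec.span {tensor k n x}"
  proof (subst cvec.span_eq, intro conjI subsetI)
    fix T assume "T \<in> {tensor k n v |v. \<forall>i\<in>{1..k}. v i \<in> point k x i}"
    then obtain v where v: "T = tensor k n v" "\<forall>i\<in>{1..k}. v i \<in> cvec.span {x i}"
      by (auto simp: point_def)
    then have "\<forall>i\<in>{1..k}. \<exists>c. v i = cscale c (x i)"
      by (auto simp: cvec.span_singleton)
    then obtain c where "\<forall>i\<in>{1..k}. v i = cscale (c i) (x i)"
      by metis
    then have "T = cscale (\<Prod>i=1..k. c i) (tensor k n x)"
      unfolding v(1) tensor_scale[symmetric] by (intro tensor_cong) auto
    then show "T \<in> cvec.span {tensor k n x}"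
      by (simp add: cvec.span_base cvec.span_scale)
  next
    fix T assume "T \<in> {tensor k n x}"
    moreover have "\<forall>i\<in>{1..k}. x i \<in> point k x i"
      by (simp add: point_def cvec.span_base)
    ultimately show "T \<in> cvec.span {tensor k n v |v. \<forall>i\<in>{1..k}. v i \<in> point k x i}"
      by (intro cvec.span_base) blast
  qed
  then show ?thesis
    by (simp add: segre_def)
qed

text \<open>Starting from an entry where no factor of \<open>v\<close> vanishes and varying only the
  \<open>i\<close>-th index, the tensor reads off \<open>v i\<close> up to a scalar.\<close>

lemma inj_on_segre: "inj_on (segre k n) (multiproj k n)"
proof (rule inj_onI)
  fix y z assume "y \<in> multiproj k n" "z \<in> multiproj k n" and eq: "segre k n y = segre k n z"
  then obtain v w where v: "y = point k v" "homog_coords k n v" and w: "z = point k w" "homog_coords k n w"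
    by (auto simp: multiproj_eq_image_point)
  obtain c where c: "c \<noteq> 0" "tensor k n v = cscale c (tensor k n w)"
    using span_singleton_eqD eq tensor_neq_0[OF v(2)] unfolding v(1) w(1) segre_point by metis
  obtain m where m: "m \<in> multi_index k n" "\<And>i. i \<in> {1..k} \<Longrightarrow> v i (m i) \<noteq> 0"
    using tensor_nonzero_entry[OF v(2)] by metis
  have "cvec.span {v i} = cvec.span {w i}" if i: "i \<in> {1..k}" for i
  proof -
    define a where "a = (\<Prod>j\<in>{1..k} - {i}. v j (m j))"
    define b where "b = c * (\<Prod>j\<in>{1..k} - {i}. w j (m j))"
    have "a \<noteq> 0"
      using m(2) by (auto simp: a_def)
    have vw: "v i p * a = w i p * b" for p
    proof (cases "p \<le> n i")
      case True
      have "m i \<le> n i"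
        using m(1) i by (auto simp: multi_index_def)
      then have "m(i := p) \<in> multi_index k n"
        using multi_index_fun_upd_iff[where p = p and n = n, OF i True] m(1) by blast
      moreover have "(\<Prod>j\<in>{1..k} - {i}. f j ((m(i := p)) j)) = (\<Prod>j\<in>{1..k} - {i}. f j (m j))"
        for f :: "nat \<Rightarrow> nat \<Rightarrow> complex"
        by (intro prod.cong) auto
      ultimately show ?thesis
        using arg_cong[OF c(2), of "\<lambda>T. T (m(i := p))"] tensor_fun_upd_apply[OF i, of n v "v i" "m(i := p)"]
          tensor_fun_upd_apply[OF i, of n w "w i" "m(i := p)"]
        by (simp add: a_def b_def cscale_def mult_ac)
    next
      case False
      then show ?thesis
        using v(2) w(2) i by (auto simp: homog_coords_def coord_space_def)
    qed
    have eq: "v i = cscale (b / a) (w i)"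
      using vw \<open>a \<noteq> 0\<close> by (simp add: fun_eq_iff cscale_def field_simps)
    moreover have "b / a \<noteq> 0"
    proof
      assume "b / a = 0"
      then have "v i = 0"
        unfolding eq by (simp only: cvec.scale_zero_left)
      then show False
        using v(2) i by (auto simp: homog_coords_def)
    qed
    ultimately show ?thesis
      by (metis span_singleton_scale)
  qed
  then show "y = z"
    by (auto simp: v(1) w(1) point_def fun_eq_iff)
qed

section \<open>Standard basis tensors and elementary matrices\<close>

lemma tensor_unit_vec:
  assumes "m \<in> multi_index k n"
  shows "tensor k n (\<lambda>i. unit_vec (m i)) = unit_vec m"
proof
  fix m'
  show "tensor k n (\<lambda>i. unit_vec (m i)) m' = unit_vec m m'"
  proof (cases "m' = m")
    case True
    then show ?thesis
      using assms by (simp add: tensor_def unit_vec_def)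
  next
    case False
    have "(\<Prod>i=1..k. unit_vec (m i) (m' i)) = (0 :: complex)" if m': "m' \<in> multi_index k n"
    proof -
      obtain i where "i \<in> {1..k}" "m' i \<noteq> m i"
        using PiE_ext[OF m'[unfolded multi_index_def] assms[unfolded multi_index_def]] False by blast
      then show ?thesis
        by (intro prod_zero) (auto simp: unit_vec_def)
    qed
    then show ?thesis
      using False by (simp add: tensor_def) (simp add: unit_vec_def)
  qed
qed

text \<open>All other unit vectors lie in the hyperplane where the \<open>j\<close>-th coordinate
  vanishes, and the \<open>j\<close>-th one does not.\<close>

lemma independent_unit_vecs: "cvec.independent (unit_vec ` J)"
proof
  assume "cvec.dependent (unit_vec ` J)"
  then obtain j where j: "unit_vec j \<in> cvec.span (unit_vec ` J - {unit_vec j})"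
    by (auto simp: cvec.dependent_def)
  have "cvec.subspace {v. v j = 0}"
    by (auto simp: cvec.subspace_def cscale_def)
  moreover have "unit_vec ` J - {unit_vec j} \<subseteq> {v. v j = 0}"
    by (auto simp: unit_vec_def)
  ultimately have "unit_vec j \<in> {v. v j = 0}"
    using j cvec.span_minimal by blast
  then show False
    by (simp add: unit_vec_def)
qed

lemma inj_unit_vec: "inj unit_vec"
proof (rule injI)
  fix i j :: 'a
  assume "unit_vec i = unit_vec j"
  from fun_cong[OF this, of i] show "i = j"
    by (simp add: unit_vec_def split: if_splits)
qed

text \<open>The action of an elementary matrix on the \<open>i\<close>-th tensor factor, sending the \<open>p\<close>-th basis
  vector to the \<open>q\<close>-th one.\<close>

definition elem_op :: "nat \<Rightarrow> nat \<Rightarrow> nat \<Rightarrow> ((nat \<Rightarrow> nat) \<Rightarrow> complex) \<Rightarrow> (nat \<Rightarrow> nat) \<Rightarrow> complex" where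
  "elem_op i p q T = (\<lambda>m. if m i = q then T (m(i := p)) else 0)"

text \<open>An elementary matrix turns the vector \<open>x i\<close> into \<open>x i p\<close> times
  a basis vector, so a decomposable tensor stays decomposable and only its \<open>i\<close>-th
  factor moves.\<close>

lemma elem_op_tensor:
  assumes "i \<in> {1..k}" "p \<le> n i" "q \<le> n i"
  shows "elem_op i p q (tensor k n x) = cscale (x i p) (tensor k n (x(i := unit_vec q)))"
proof
  fix m
  have "(\<Prod>j\<in>{1..k} - {i}. x j ((m(i := p)) j)) = (\<Prod>j\<in>{1..k} - {i}. x j (m j))"
    by (intro prod.cong) auto
  then show "elem_op i p q (tensor k n x) m = cscale (x i p) (tensor k n (x(i := unit_vec q))) m"
    using multi_index_fun_upd_iff[where m = m and n = n and p = p, OF assms(1,2)] assms(3)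
      tensor_fun_upd_apply[OF assms(1), of n x "x i" "m(i := p)"]
      tensor_fun_upd_apply[OF assms(1), of n x "unit_vec q" m]
    by (auto simp: elem_op_def unit_vec_def cscale_def)
qed

lemma elem_op_span_closed:
  assumes "\<And>T. T \<in> B \<Longrightarrow> elem_op i p q T \<in> cvec.span B" "T \<in> cvec.span B"
  shows "elem_op i p q T \<in> cvec.span B"
proof -
  have add: "elem_op i p q (T + T') = elem_op i p q T + elem_op i p q T'" for T T'
    by (auto simp: elem_op_def fun_eq_iff cscale_def)
  have scale: "elem_op i p q (cscale c T) = cscale c (elem_op i p q T)" for c T
    by (auto simp: elem_op_def fun_eq_iff cscale_def)
  have zero: "elem_op i p q 0 = 0"
    by (auto simp: elem_op_def fun_eq_iff cscale_def)
  have "cvec.subspace {T. elem_op i p q T \<in> cvec.span B}"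
    by (rule cvec.subspaceI) (simp_all add: add scale zero cvec.span_add cvec.span_scale cvec.span_zero)
  then show ?thesis
    using assms cvec.span_minimal[of B "{T. elem_op i p q T \<in> cvec.span B}"] by blast
qed

text \<open>If the span of the tensors contains every line through every one of the given points of the
  Segre variety, then it is stable under all elementary matrices in all factors. Such a subspace is
  everything as soon as it is nonzero.\<close>

lemma unit_vecs_subset_span_tensors:
  assumes closed: "\<And>x i q. x \<in> R \<Longrightarrow> i \<in> {1..k} \<Longrightarrow> q \<le> n i \<Longrightarrow>
      tensor k n (x(i := unit_vec q)) \<in> cvec.span (tensor k n ` R)"
    and "x \<in> R" "homog_coords k n x"
  shows "unit_vec ` multi_index k n \<subseteq> cvec.span (tensor k n ` R)"
proof (rule image_subsetI)
  fix m assume m: "m \<in> multi_index k n"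
  let ?L = "cvec.span (tensor k n ` R)"
  have L: "elem_op i p q T \<in> ?L" if "i \<in> {1..k}" "p \<le> n i" "q \<le> n i" "T \<in> ?L" for i p q T
  proof (rule elem_op_span_closed[OF _ that(4)])
    fix T assume "T \<in> tensor k n ` R"
    then obtain x where "x \<in> R" "T = tensor k n x"
      by blast
    then show "elem_op i p q T \<in> ?L"
      using cvec.span_scale[OF closed[OF _ that(1,3)]] by (simp add: elem_op_tensor[where n = n, OF that(1-3)])
  qed
  obtain m0 where m0: "m0 \<in> multi_index k n" "\<And>i. i \<in> {1..k} \<Longrightarrow> x i (m0 i) \<noteq> 0"
    using tensor_nonzero_entry[OF assms(3)] by metis
  \<comment> \<open>The factors of \<open>x\<close> are replaced by the wanted basis vectors one
    after the other, without leaving the span.\<close>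
  have "tensor k n (\<lambda>i. if i \<le> j then unit_vec (m i) else x i) \<in> ?L" if "j \<le> k" for j
    using that
  proof (induction j)
    case 0
    \<comment> \<open>Only index \<open>0\<close> is altered, and the factors are numbered from
      \<open>1\<close>.\<close>
    have "tensor k n (\<lambda>i. if i \<le> 0 then unit_vec (m i) else x i) = tensor k n x"
      by (rule tensor_cong) auto
    then show ?case
      using \<open>x \<in> R\<close> by (simp add: cvec.span_base)
  next
    case (Suc j)
    let ?y = "\<lambda>i. if i \<le> j then unit_vec (m i) else x i"
    have j: "Suc j \<in> {1..k}" "m0 (Suc j) \<le> n (Suc j)" "m (Suc j) \<le> n (Suc j)"
      using Suc.prems m m0(1) by (auto simp: multi_index_def PiE_iff)
    \<comment> \<open>Factor \<open>Suc j\<close> is still that of \<open>x\<close>, so its entry at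
      \<open>m0 (Suc j)\<close> is nonzero and can be divided out afterwards.\<close>
    have "elem_op (Suc j) (m0 (Suc j)) (m (Suc j)) (tensor k n ?y) \<in> ?L"
      using L[OF j] Suc by simp
    then have "cscale (x (Suc j) (m0 (Suc j))) (tensor k n (?y(Suc j := unit_vec (m (Suc j))))) \<in> ?L"
      by (simp add: elem_op_tensor[where n = n, OF j])
    from cvec.span_scale[OF this, of "1 / x (Suc j) (m0 (Suc j))"]
    have "tensor k n (?y(Suc j := unit_vec (m (Suc j)))) \<in> ?L"
      using m0(2)[OF j(1)] by simp
    moreover have "?y(Suc j := unit_vec (m (Suc j))) = (\<lambda>i. if i \<le> Suc j then unit_vec (m i) else x i)"
      by (auto simp: fun_eq_iff)
    ultimately show ?case
      by simp
  qed
  from this[of k] have "tensor k n (\<lambda>i. if i \<le> k then unit_vec (m i) else x i) \<in> ?L"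
    by simp
  also have "tensor k n (\<lambda>i. if i \<le> k then unit_vec (m i) else x i) = tensor k n (\<lambda>i. unit_vec (m i))"
    by (rule tensor_cong) simp
  finally show "unit_vec m \<in> ?L"
    by (simp add: tensor_unit_vec[OF m])
qed

text \<open>Too few tensors cannot span the whole space, so replacing some factor \<open>x i\<close>
  of some point by a basis vector leaves their span. Writing \<open>x i\<close> as that basis vector
  plus the remainder splits the tensor, by linearity in the factor \<open>i\<close>.\<close>

lemma exists_splitting:
  assumes "finite R" "R \<noteq> {}" "\<And>x. x \<in> R \<Longrightarrow> homog_coords k n x"
    and "card R < (\<Prod>i=1..k. n i + 1)"
  obtains x u w where "x \<in> R" "homog_coords k n u" "homog_coords k n w"
    "tensor k n x = tensor k n u + tensor k n w" "tensor k n u \<notin> cvec.span (tensor k n ` R)"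
proof -
  let ?L = "cvec.span (tensor k n ` R)"
  have "\<not> unit_vec ` multi_index k n \<subseteq> ?L"
  proof
    assume "unit_vec ` multi_index k n \<subseteq> ?L"
    then have "card (unit_vec ` multi_index k n) \<le> card (tensor k n ` R)"
      using cvec.independent_span_bound independent_unit_vecs assms(1) by blast
    also have "\<dots> \<le> card R"
      by (rule card_image_le[OF assms(1)])
    finally show False
      using assms(4) card_image[OF inj_on_subset[OF inj_unit_vec], of "multi_index k n"]
      by (simp only: card_multi_index) simp
  qed
  then obtain x i q where x: "x \<in> R" "i \<in> {1..k}" "q \<le> n i" "tensor k n (x(i := unit_vec q)) \<notin> ?L"
    using unit_vecs_subset_span_tensors assms(2,3) by (metis ex_in_conv)
  let ?u = "x(i := unit_vec q)" and ?w = "x(i := x i - unit_vec q)"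
  have hx: "homog_coords k n x"
    using assms(3) x(1) by blast
  have q: "unit_vec q \<in> coord_space {..n i}" "unit_vec q \<noteq> (0 :: nat \<Rightarrow> complex)"
    using x(3) by (auto simp: coord_space_def unit_vec_def fun_eq_iff)
  \<comment> \<open>The remainder must be nonzero to define a projective point. Otherwise the
    modified tensor would be that of \<open>x\<close> itself, which lies in the span.\<close>
  have "x i \<noteq> unit_vec q"
  proof
    assume "x i = unit_vec q"
    then have "x(i := unit_vec q) = x"
      by (metis fun_upd_triv)
    then show False
      using x(1,4) by (simp add: cvec.span_base)
  qed
  moreover have "x i - unit_vec q \<in> coord_space {..n i}"
    using hx x(2) q(1) by (intro cvec.subspace_diff subspace_coord_space) (auto simp: homog_coords_def)
  ultimately have "homog_coords k n ?w"
    using hx by (simp add: homog_coords_def)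
  moreover have "homog_coords k n ?u"
    using hx q by (simp add: homog_coords_def)
  moreover have "tensor k n x = tensor k n ?u + tensor k n ?w"
    using tensor_fun_upd_diff[OF x(2), of n x "x i" "unit_vec q"] by simp
  ultimately show ?thesis
    using that x by blast
qed

section \<open>Non-redundant decompositions\<close>

lemma nonredundant_decompositionI:
  assumes "finite S" "S \<noteq> {}" "S \<subseteq> multiproj k n"
    and seg: "\<And>s. s \<in> S \<Longrightarrow> segre k n s = cvec.span {t s}"
    and inj: "inj_on t S" and ind: "cvec.independent (t ` S)"
    and c: "\<And>s. s \<in> S \<Longrightarrow> c s \<noteq> 0"
  shows "nonredundant_decomposition k n S (cvec.span {\<Sum>s\<in>S. cscale (c s) (t s)})"
proof -
  let ?T = "\<Sum>s\<in>S. cscale (c s) (t s)"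
  have not_span: "?T \<notin> cvec.span (t ` (S - {s}))" if "s \<in> S" for s
  proof
    assume T: "?T \<in> cvec.span (t ` (S - {s}))"
    have "(\<Sum>s\<in>S - {s}. cscale (c s) (t s)) \<in> cvec.span (t ` (S - {s}))"
      by (intro cvec.span_sum cvec.span_scale cvec.span_base) auto
    with T have "?T - (\<Sum>s\<in>S - {s}. cscale (c s) (t s)) \<in> cvec.span (t ` (S - {s}))"
      by (rule cvec.span_diff)
    also have "?T - (\<Sum>s\<in>S - {s}. cscale (c s) (t s)) = cscale (c s) (t s)"
      using assms(1) that by (simp add: sum.remove)
    finally have "cscale (1 / c s) (cscale (c s) (t s)) \<in> cvec.span (t ` (S - {s}))"
      by (rule cvec.span_scale)
    then have "t s \<in> cvec.span (t ` (S - {s}))"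
      using c[OF that] by simp
    moreover have "t ` (S - {s}) = t ` S - {t s}"
      using inj_on_image_set_diff[OF inj, of S "{s}"] that by simp
    ultimately show False
      using ind that by (auto simp: cvec.dependent_def)
  qed
  have T0: "?T \<noteq> 0"
    using not_span assms(2) cvec.span_zero by fastforce
  have sub: "cvec.span (\<Union>(segre k n ` S')) = cvec.span (t ` S')" if "S' \<subseteq> S" for S'
    using that by (intro span_Union_lines seg) auto
  have "?T \<in> cvec.span (t ` S)"
    by (intro cvec.span_sum cvec.span_scale cvec.span_base) auto
  then have "is_decomposition k n S (cvec.span {?T})"
    using T0 assms(1,3) sub[of S] by (auto simp: is_decomposition_def proj_span_def)
  moreover have "cvec.span {?T} \<notin> proj_span (segre k n ` S')" if S': "S' \<subset> S" for S'
  proof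
    assume "cvec.span {?T} \<in> proj_span (segre k n ` S')"
    then obtain v where v: "cvec.span {?T} = cvec.span {v}" "v \<in> cvec.span (t ` S')"
      using S' sub[of S'] by (auto simp: proj_span_def)
    \<comment> \<open>Points agree only as lines, so the representative is determined up to a
      scalar.\<close>
    obtain a where "?T = cscale a v"
      using span_singleton_eqD[OF v(1) T0] by metis
    then have T: "?T \<in> cvec.span (t ` S')"
      using v(2) by (simp add: cvec.span_scale)
    \<comment> \<open>Any proper subset misses some \<open>s\<close>, so it suffices to exclude the
      removal of one point.\<close>
    obtain s where s: "s \<in> S" "S' \<subseteq> S - {s}"
      using S' by blast
    then have "cvec.span (t ` S') \<subseteq> cvec.span (t ` (S - {s}))"
      by (intro cvec.span_mono image_mono)
    then show False
      using T not_span[OF s(1)] by blast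
  qed
  ultimately show ?thesis
    by (simp add: nonredundant_decomposition_def)
qed

text \<open>Projective independence speaks of the set of image points. Injectivity of the Segre map
  ensures that deleting an image point is the same as deleting one element of \<open>A\<close>,
  hence one vector.\<close>

lemma proj_independent_imp_independent:
  assumes "proj_independent (segre k n ` A)" "A \<subseteq> multiproj k n"
    and seg: "\<And>y. y \<in> A \<Longrightarrow> segre k n y = cvec.span {t y}"
    and nz: "\<And>y. y \<in> A \<Longrightarrow> t y \<noteq> 0"
  shows "cvec.independent (t ` A)" "inj_on t A"
proof -
  show inj: "inj_on t A"
    using inj_on_subset[OF inj_on_segre assms(2)] seg by (auto simp: inj_on_def)
  show "cvec.independent (t ` A)"
  proof
    assume "cvec.dependent (t ` A)"
    then obtain y where y: "y \<in> A" "t y \<in> cvec.span (t ` A - {t y})"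
      by (auto simp: cvec.dependent_def)
    have "t ` A - {t y} = t ` (A - {y})"
      using inj_on_image_set_diff[OF inj, of A "{y}"] y(1) by simp
    also have "cvec.span \<dots> = cvec.span (\<Union>(segre k n ` (A - {y})))"
      by (rule span_Union_lines[symmetric]) (simp add: seg)
    also have "segre k n ` (A - {y}) = segre k n ` A - {segre k n y}"
      using inj_on_image_set_diff[OF inj_on_subset[OF inj_on_segre assms(2)], of A "{y}"] y(1) by simp
    finally have "segre k n y \<in> proj_span (segre k n ` A - {segre k n y})"
      using y nz seg unfolding proj_span_def by auto
    then show False
      using assms(1) y(1) by (auto simp: proj_independent_def)
  qed
qed

section \<open>Exchange of one point of \<open>A\<close> for two new ones\<close>

theorem theorem3p8:
  fixes k M r :: nat
    and n :: "nat \<Rightarrow> nat"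
    and A :: "(nat \<Rightarrow> (nat \<Rightarrow> complex) set) set"
  assumes "M + 1 = (\<Prod>i=1..k. n i + 1)"
    and "\<exists>i\<in>{1..k}. n i > 0"
    and "finite A" and "A \<subseteq> multiproj k n"
    and "card A = r" and "r \<le> M"
    and "proj_independent (segre k n ` A)"
  shows "holds_for_general (multi_index k n) (proj_span (segre k n ` A))
           (\<lambda>T. \<exists>S. card S = r + 1 \<and> nonredundant_decomposition k n S T)"
proof (cases "A = {}")
  case True
  \<comment> \<open>The span of no points is empty, and the empty set is open and dense in
    it.\<close>
  then have "proj_span (segre k n ` A) = {}"
    by (simp add: proj_span_def)
  then show ?thesis
    by (auto simp: holds_for_general_def intro!: exI[of _ "{}"])
next
  case False
  have "\<forall>y\<in>A. \<exists>x. homog_coords k n x \<and> y = point k x"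
    using assms(4) by (auto simp: multiproj_eq_image_point)
  then obtain x where x: "\<And>y. y \<in> A \<Longrightarrow> homog_coords k n (x y)" "\<And>y. y \<in> A \<Longrightarrow> y = point k (x y)"
    by metis
  define t where "t y = tensor k n (x y)" for y
  have seg: "segre k n y = cvec.span {t y}" if "y \<in> A" for y
    using x(2)[OF that] segre_point unfolding t_def by metis
  have ind: "cvec.independent (t ` A)" and inj: "inj_on t A"
    using proj_independent_imp_independent[OF assms(7,4), of t] seg x(1) tensor_neq_0
    by (auto simp: t_def)
  have "card (x ` A) < (\<Prod>i=1..k. n i + 1)"
    using card_image_le[OF assms(3), of x] assms(1,5,6) by linarith
  moreover have "finite (x ` A)" "x ` A \<noteq> {}" "\<And>z. z \<in> x ` A \<Longrightarrow> homog_coords k n z"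
    using assms(3) False x(1) by auto
  ultimately obtain z u w where z: "z \<in> x ` A" and uw: "homog_coords k n u" "homog_coords k n w"
      and zuw: "tensor k n z = tensor k n u + tensor k n w"
      and u: "tensor k n u \<notin> cvec.span (tensor k n ` x ` A)"
    using exists_splitting[of "x ` A" k n] by blast
  obtain a where a: "a \<in> A" "z = x a"
    using z by blast
  define tu where "tu = tensor k n u"
  define tw where "tw = tensor k n w"
  have split: "t a = tu + tw"
    using zuw a(2) by (simp add: t_def tu_def tw_def)
  have tu: "tu \<notin> cvec.span (t ` A)"
    using u by (simp add: t_def tu_def image_image)
  have ta: "t a \<in> cvec.span (t ` A)"
    using a(1) by (simp add: cvec.span_base)
  have tw: "tw \<notin> cvec.span (t ` A)"
  proof
    assume "tw \<in> cvec.span (t ` A)"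
    with ta have "t a - tw \<in> cvec.span (t ` A)"
      by (rule cvec.span_diff)
    then show False
      using tu split by simp
  qed
  define b where "b = point k u"
  define c where "c = point k w"
  have segbc: "segre k n b = cvec.span {tu}" "segre k n c = cvec.span {tw}"
    by (simp_all add: b_def c_def tu_def tw_def segre_point)
  have bA: "b \<notin> A"
  proof
    assume "b \<in> A"
    then have "cvec.span {tu} \<subseteq> cvec.span (t ` A)"
      using seg segbc(1) by (metis cvec.span_mono empty_subsetI image_eqI insert_subset)
    then show False
      using tu cvec.span_base by blast
  qed
  have cA: "c \<notin> A"
  proof
    assume "c \<in> A"
    then have "cvec.span {tw} \<subseteq> cvec.span (t ` A)"
      using seg segbc(2) by (metis cvec.span_mono empty_subsetI image_eqI insert_subset)
    then show False
      using tw cvec.span_base by blast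
  qed
  let ?A' = "A - {a}"
  have tA: "t ` A = insert (t a) (t ` ?A')"
    using a(1) by auto
  have ta': "t a \<notin> t ` ?A'"
    using inj a(1) by (auto simp: inj_on_def)
  have ind_a: "cvec.independent (insert tu (t ` A))"
    by (rule cvec.independent_insertI[OF tu ind])
  have "tu \<notin> t ` A" "tu \<noteq> t a"
    using tu ta by (auto intro: cvec.span_base)
  then have eq: "insert tu (t ` A) - {t a} = insert tu (t ` ?A')"
    unfolding tA using ta' by blast
  have tw': "tw \<notin> cvec.span (insert tu (t ` ?A'))"
  proof
    assume "tw \<in> cvec.span (insert tu (t ` ?A'))"
    moreover have "tu \<in> cvec.span (insert tu (t ` ?A'))"
      by (simp add: cvec.span_base)
    ultimately have "tu + tw \<in> cvec.span (insert tu (t ` ?A'))"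
      by (intro cvec.span_add)
    then have "t a \<in> cvec.span (insert tu (t ` A) - {t a})"
      unfolding eq by (simp only: split)
    then show False
      using ind_a a(1) by (auto simp: cvec.dependent_def)
  qed
  have "cvec.independent (insert tu (t ` ?A'))"
    using ind_a by (rule cvec.independent_mono) (use tA in auto)
  then have ind': "cvec.independent (insert tw (insert tu (t ` ?A')))"
    by (rule cvec.independent_insertI[OF tw'])
  have "tw \<noteq> tu" "tw \<notin> t ` ?A'"
    using tw' by (auto intro: cvec.span_base)
  have "b \<noteq> c"
  proof
    assume "b = c"
    then have "tw \<in> cvec.span {tu}"
      using segbc cvec.span_base by (metis singletonI)
    moreover have "cvec.span {tu} \<subseteq> cvec.span (insert tu (t ` ?A'))"
      by (intro cvec.span_mono) auto
    ultimately show False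
      using tw' by blast
  qed
  define S where "S = insert c (insert b ?A')"
  \<comment> \<open>The representatives of \<open>b\<close> and \<open>c\<close> are chosen to add
    up to \<open>t a\<close> exactly.\<close>
  define t' where "t' = t(b := tu, c := tw)"
  have t': "t' b = tu" "t' c = tw" "\<And>y. y \<in> A \<Longrightarrow> t' y = t y"
    using \<open>b \<noteq> c\<close> bA cA by (auto simp: t'_def)
  have S: "finite S" "S \<noteq> {}" "card S = r + 1"
    using assms(3,5) a(1) bA cA \<open>b \<noteq> c\<close> card_gt_0_iff[of A] by (auto simp: S_def)
  have S_sub: "S \<subseteq> multiproj k n"
    using assms(4) uw by (auto simp: S_def b_def c_def multiproj_eq_image_point)
  have seg': "segre k n s = cvec.span {t' s}" if "s \<in> S" for s
    using that seg segbc t' by (auto simp: S_def)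
  have im: "t' ` S = insert tw (insert tu (t ` ?A'))"
    using t' by (auto simp: S_def)
  have "inj_on t' ?A'"
    using inj t'(3) by (auto simp: inj_on_def)
  then have inj': "inj_on t' S"
    using t' \<open>tw \<noteq> tu\<close> \<open>tw \<notin> t ` ?A'\<close> \<open>tu \<notin> t ` A\<close> by (auto simp: S_def)
  have dec: "\<exists>S. card S = r + 1 \<and> nonredundant_decomposition k n S
               (cvec.span {\<Sum>v\<in>t ` A. cscale (d v) v})"
    if d: "\<And>v. v \<in> t ` A \<Longrightarrow> d v \<noteq> 0" for d
  proof (intro exI[of _ S] conjI S(3))
    \<comment> \<open>Both new points inherit the coefficient of \<open>a\<close>, so that their two
      terms recombine to the term of \<open>t a\<close>.\<close>
    define e where "e = (\<lambda>y. d (t y))(b := d (t a), c := d (t a))"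
    have e: "e b = d (t a)" "e c = d (t a)" "\<And>y. y \<in> A \<Longrightarrow> e y = d (t y)"
      using bA cA by (auto simp: e_def)
    have "nonredundant_decomposition k n S (cvec.span {\<Sum>s\<in>S. cscale (e s) (t' s)})"
    proof (rule nonredundant_decompositionI[OF S(1,2) S_sub seg' inj'])
      show "cvec.independent (t' ` S)"
        using ind' im by simp
      show "e s \<noteq> 0" if "s \<in> S" for s
        using that e d a(1) by (auto simp: S_def)
    qed
    also have "(\<Sum>s\<in>S. cscale (e s) (t' s)) = (\<Sum>v\<in>t ` A. cscale (d v) v)"
    proof -
      have "(\<Sum>s\<in>S. cscale (e s) (t' s)) =
          cscale (d (t a)) tw + (cscale (d (t a)) tu + (\<Sum>y\<in>?A'. cscale (e y) (t' y)))"
        unfolding S_def using assms(3) bA cA \<open>b \<noteq> c\<close> by (simp add: e t')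
      also have "(\<Sum>y\<in>?A'. cscale (e y) (t' y)) = (\<Sum>y\<in>?A'. cscale (d (t y)) (t y))"
        by (intro sum.cong) (auto simp: e t')
      also have "cscale (d (t a)) tw + (cscale (d (t a)) tu + (\<Sum>y\<in>?A'. cscale (d (t y)) (t y))) =
          cscale (d (t a)) (t a) + (\<Sum>y\<in>?A'. cscale (d (t y)) (t y))"
        unfolding split by (simp add: cvec.scale_right_distrib add_ac)
      also have "\<dots> = (\<Sum>y\<in>A. cscale (d (t y)) (t y))"
        using assms(3) a(1) by (simp add: sum.remove)
      also have "\<dots> = (\<Sum>v\<in>t ` A. cscale (d v) v)"
        by (simp add: sum.reindex[OF inj])
      finally show ?thesis .
    qed
    finally show "nonredundant_decomposition k n S (cvec.span {\<Sum>v\<in>t ` A. cscale (d v) v})" .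
  qed
  show ?thesis
  proof (rule holds_for_general_span[OF finite_multi_index _ _ ind])
    show "finite (t ` A)" "t ` A \<noteq> {}"
      using assms(3) False by auto
    show "t ` A \<subseteq> coord_space (multi_index k n)"
      by (auto simp: t_def tensor_in_coord_space)
    show "cvec.span (\<Union>(segre k n ` A)) = cvec.span (t ` A)"
      by (rule span_Union_lines) (rule seg)
  qed (rule dec)
qed

end
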